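(* Let $R$ be a local ring with unique maximal ideal $M$. Then every proper ideal of $R$ is weakly $1$-absorbing prime if and only if $M^3=\{0\}$.
   Context: All rings are commutative with identity. A ring is called local if it has a unique maximal ideal. A proper ideal $I$ of a ring $R$ (i.e. $I\neq R$) is called weakly $1$-absorbing prime if for all nonunit elements $a,b,c\in R$ with $0\neq abc\in I$, either $ab\in I$ or $c\in I$. *)

theory Defs
  imports "HOL-Algebra.Ideal_Product"
begin

locale local_ring = cring +
  assumes unique_maximalideal: "\<exists>!M. maximalideal M R"

locale weakly_1_absorbing_prime_ideal = ideal I R + cring R for I and R (structure) +
  assumes I_notcarr: "carrier R \<noteq> I"
    and weakly_1_absorbing:
      "\<lbrakk>a \<in> carrier R - Units R; b \<in> carrier R - Units R; c \<in> carrier R - Units R;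
        a \<otimes> b \<otimes> c \<noteq> \<zero>; a \<otimes> b \<otimes> c \<in> I\<rbrakk> \<Longrightarrow> a \<otimes> b \<in> I \<or> c \<in> I"

end

theory Submission
  imports Defs "HOL-Algebra.Ring_Divisibility"
begin

text \<open>
  If \<open>a b c \<noteq> 0\<close> with \<open>a, b, c \<in> M\<close>, then the proper ideal \<open>(a b c)\<close> would contain \<open>a b\<close> or \<open>c\<close>,
  so that \<open>a b = (r c) (a b)\<close> or \<open>c = (r a b) c\<close> for some \<open>r\<close>. As \<open>1 - x\<close> is a unit for every
  \<open>x \<in> M\<close>, this forces \<open>a b = 0\<close> or \<open>c = 0\<close>. Conversely, the nonunits all lie in \<open>M\<close>, so if
  \<open>M\<^sup>3 = 0\<close> then the defining condition is vacuous.
\<close>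

text \<open>Zorn's lemma applies to the ideals above \<open>I\<close> that avoid
  \<open>\<one>\<close>. Stating properness as \<open>\<one> \<notin> J\<close> makes it visibly
  pass to the union of a chain.\<close>

lemma (in ring) proper_ideal_subset_maximalideal:
  assumes I: "ideal I R" and proper: "I \<noteq> carrier R"
  obtains M where "maximalideal M R" "I \<subseteq> M"
proof -
  define A where "A = {J. ideal J R \<and> I \<subseteq> J \<and> \<one> \<notin> J}"
  have "I \<in> A"
    using I proper ideal.one_imp_carrier unfolding A_def by blast
  have "\<exists>N\<in>A. \<forall>X\<in>A. N \<subseteq> X \<longrightarrow> X = N"
  proof (rule subset_Zorn_nonempty)
    show "A \<noteq> {}"
      using \<open>I \<in> A\<close> by blast
  next
    fix C assume C: "C \<noteq> {}" "subset.chain A C"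
    have "C \<subseteq> A"
      using C(2) by (simp add: subset_chain_def)
    then have "subset.chain {J. ideal J R} C"
      using C(2) unfolding subset_chain_def A_def by blast
    from chain_Union_is_ideal[OF this] have "ideal (\<Union>C) R"
      using C(1) by simp
    then show "\<Union>C \<in> A"
      using C(1) \<open>C \<subseteq> A\<close> unfolding A_def by blast
  qed
  then obtain N where "N \<in> A" and max: "\<And>X. \<lbrakk>X \<in> A; N \<subseteq> X\<rbrakk> \<Longrightarrow> X = N"
    by blast
  then have N: "ideal N R" "I \<subseteq> N" "\<one> \<notin> N"
    by (auto simp: A_def)
  have "maximalideal N R"
  proof (rule maximalidealI[OF N(1)])
    show "carrier R \<noteq> N"
      using N(3) by auto
  next
    \<comment> \<open>An ideal above \<open>N\<close> either contains \<open>\<one>\<close> and is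
      the whole ring, or belongs to \<open>A\<close> and equals \<open>N\<close> by
      maximality.\<close>
    fix J assume J: "ideal J R" "N \<subseteq> J"
    show "J = N \<or> J = carrier R"
    proof (cases "\<one> \<in> J")
      case True
      then show ?thesis
        using ideal.one_imp_carrier[OF J(1)] by blast
    next
      case False
      then have "J \<in> A"
        using J N(2) by (auto simp: A_def)
      then show ?thesis
        using max J(2) by blast
    qed
  qed
  then show thesis
    using N(2) that by blast
qed

context local_ring
begin

lemma proper_ideal_subset:
  assumes M: "maximalideal M R" and "ideal I R" "I \<noteq> carrier R"
  shows "I \<subseteq> M"
  using proper_ideal_subset_maximalideal[OF assms(2,3)] unique_maximalideal M by metis

text \<open>A unit in \<open>M\<close> would put \<open>\<one>\<close> in \<open>M\<close>, while a
  nonunit generates a proper ideal, which lies in \<open>M\<close> by locality. This links the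
  nonunits in the definition of weakly 1-absorbing prime to membership in \<open>M\<close>.\<close>

lemma maximalideal_eq_nonunits:
  assumes M: "maximalideal M R"
  shows "M = carrier R - Units R"
proof (intro equalityI subsetI)
  interpret M: maximalideal M R by (rule M)
  fix x assume x: "x \<in> M"
  have "x \<notin> Units R"
  proof
    assume "x \<in> Units R"
    then have "\<one> \<in> M"
      using M.I_l_closed[OF x, of "inv x"] by simp
    then show False
      using M.one_imp_carrier M.I_notcarr by blast
  qed
  then show "x \<in> carrier R - Units R"
    using M.Icarr[OF x] by blast
next
  fix x assume x: "x \<in> carrier R - Units R"
  have "\<one> \<notin> PIdl x"
  proof
    assume "\<one> \<in> PIdl x"
    then obtain y where "y \<in> carrier R" "y \<otimes> x = \<one>"
      unfolding cgenideal_def by auto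
    then show False
      using x m_comm unfolding Units_def by auto
  qed
  then have "PIdl x \<noteq> carrier R"
    by auto
  then have "PIdl x \<subseteq> M"
    using proper_ideal_subset[OF M] cgenideal_ideal x by blast
  then show "x \<in> M"
    using cgenideal_self x by blast
qed

text \<open>This is Nakayama's lemma for the principal ideal of \<open>y\<close>: the element
  \<open>\<one> \<ominus> x\<close> annihilates \<open>y\<close>, and it is a unit because adding
  \<open>x\<close> to it gives \<open>\<one>\<close>, which is not in \<open>M\<close>.\<close>

lemma maximalideal_mult_fixed:
  assumes M: "maximalideal M R" and x: "x \<in> M" and y: "y \<in> carrier R" and xy: "y = x \<otimes> y"
  shows "y = \<zero>"
proof -
  interpret M: maximalideal M R by (rule M)
  have xR: "x \<in> carrier R"
    using x by (rule M.Icarr)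
  have "\<one> \<ominus> x \<notin> M"
  proof
    assume "\<one> \<ominus> x \<in> M"
    then have "(\<one> \<ominus> x) \<oplus> x \<in> M"
      using x by (rule M.a_closed)
    also have "(\<one> \<ominus> x) \<oplus> x = \<one>"
      using xR by (simp add: minus_eq a_assoc l_neg)
    finally show False
      using M.one_imp_carrier M.I_notcarr by blast
  qed
  then have unit: "\<one> \<ominus> x \<in> Units R"
    using maximalideal_eq_nonunits[OF M] xR by auto
  have "(\<one> \<ominus> x) \<otimes> y = y \<ominus> x \<otimes> y"
    using xR y by (simp add: minus_eq l_distr l_minus)
  also have "\<dots> = y \<ominus> y"
    using xy by simp
  \<comment> \<open>Zero is written as a multiple of \<open>\<one> \<ominus> x\<close> so that this
    unit can be cancelled.\<close>
  also have "\<dots> = (\<one> \<ominus> x) \<otimes> \<zero>"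
    using xR y by (simp add: minus_eq r_neg)
  finally show ?thesis
    using Units_l_cancel[OF unit] y by blast
qed

end

text \<open>Sums of zero products stay zero. Nonemptiness supplies an actual product, which shows
  that \<open>\<zero>\<close> itself lies in \<open>I \<cdot> J\<close>.\<close>

lemma ideal_prod_eq_zeroI:
  fixes R (structure)
  assumes "ring R" "I \<noteq> {}" "J \<noteq> {}" and zero: "\<And>i j. \<lbrakk>i \<in> I; j \<in> J\<rbrakk> \<Longrightarrow> i \<otimes> j = \<zero>"
  shows "I \<cdot> J = {\<zero>}"
proof
  interpret ring R by fact
  show "I \<cdot> J \<subseteq> {\<zero>}"
  proof
    fix x assume "x \<in> I \<cdot> J"
    then show "x \<in> {\<zero>}"
      by (induct rule: ideal_prod.induct) (simp_all add: zero)
  qed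
  obtain i j where "i \<in> I" "j \<in> J"
    using assms(2,3) by blast
  then show "{\<zero>} \<subseteq> I \<cdot> J"
    using ideal_prod.prod[of i I j J R] zero by simp
qed

text \<open>Elements of \<open>I \<cdot> J\<close> are sums of products, so by distributivity it
  suffices that each \<open>c\<close> in \<open>K\<close> annihilates the generators
  \<open>a \<otimes> b\<close>. This reduces the cube of \<open>M\<close> to triples of
  elements.\<close>

lemma (in cring) ideal_prod3_eq_zero_iff:
  assumes "ideal I R" "ideal J R" "ideal K R"
  shows "I \<cdot> J \<cdot> K = {\<zero>} \<longleftrightarrow> (\<forall>a\<in>I. \<forall>b\<in>J. \<forall>c\<in>K. a \<otimes> b \<otimes> c = \<zero>)"
proof
  assume "I \<cdot> J \<cdot> K = {\<zero>}"
  then show "\<forall>a\<in>I. \<forall>b\<in>J. \<forall>c\<in>K. a \<otimes> b \<otimes> c = \<zero>"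
    by (metis ideal_prod.prod singletonD)
next
  assume zero: "\<forall>a\<in>I. \<forall>b\<in>J. \<forall>c\<in>K. a \<otimes> b \<otimes> c = \<zero>"
  have nonempty: "L \<noteq> {}" if "ideal L R" for L
    using additive_subgroup.zero_closed[OF ideal.axioms(1)[OF that]] by blast
  have "x \<otimes> c = \<zero>" if "x \<in> I \<cdot> J" "c \<in> K" for x c
    using that(1)
  proof (induct rule: ideal_prod.induct)
    case (prod a b)
    then show ?case
      using zero that(2) by blast
  next
    case (sum s t)
    then have "s \<in> carrier R" "t \<in> carrier R"
      using ideal_prod_in_carrier[OF assms(1,2)] by auto
    then show ?case
      using sum ideal.Icarr[OF assms(3) that(2)] by (simp add: l_distr)
  qed
  then show "I \<cdot> J \<cdot> K = {\<zero>}"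
    using nonempty[OF ideal_prod_is_ideal[OF assms(1,2)]] nonempty[OF assms(3)]
    by (intro ideal_prod_eq_zeroI[OF ring_axioms]) auto
qed

theorem theorem3p2:
  fixes R :: "('a, 'b) ring_scheme" (structure) and M :: "'a set"
  assumes "local_ring R"
    and "maximalideal M R"
  shows "(\<forall>I. ideal I R \<and> I \<noteq> carrier R \<longrightarrow> weakly_1_absorbing_prime_ideal I R)
    \<longleftrightarrow> M \<cdot> M \<cdot> M = {\<zero>}"
proof -
  interpret local_ring R by fact
  interpret M: maximalideal M R by fact
  note nonunits = maximalideal_eq_nonunits[OF assms(2)]
  note fixed = maximalideal_mult_fixed[OF assms(2)]
  show ?thesis
    unfolding ideal_prod3_eq_zero_iff[OF M.is_ideal M.is_ideal M.is_ideal]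
  proof (intro iffI ballI allI impI)
    fix a b c
    assume all: "\<forall>I. ideal I R \<and> I \<noteq> carrier R \<longrightarrow> weakly_1_absorbing_prime_ideal I R"
      and abc: "a \<in> M" "b \<in> M" "c \<in> M"
    then have R: "a \<in> carrier R" "b \<in> carrier R" "c \<in> carrier R"
      using M.Icarr by auto
    show "a \<otimes> b \<otimes> c = \<zero>"
    proof (rule ccontr)
      assume nz: "a \<otimes> b \<otimes> c \<noteq> \<zero>"
      define I where "I = PIdl (a \<otimes> b \<otimes> c)"
      have I: "ideal I R"
        unfolding I_def using R by (intro cgenideal_ideal) simp
      have "a \<otimes> b \<otimes> c \<in> M"
        using abc R by (intro M.I_l_closed) simp_all
      \<comment> \<open>Containment in \<open>M\<close> makes the test ideal proper, so the
        assumption applies to it.\<close>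
      then have "I \<subseteq> M"
        unfolding I_def by (rule cgenideal_minimal[OF M.is_ideal])
      then have "I \<noteq> carrier R"
        using M.I_notcarr M.a_subset by blast
      then interpret I: weakly_1_absorbing_prime_ideal I R
        using all I by blast
      have "a \<otimes> b \<otimes> c \<in> I"
        unfolding I_def using R by (intro cgenideal_self) simp
      then have "a \<otimes> b \<in> I \<or> c \<in> I"
        using I.weakly_1_absorbing nz abc nonunits by blast
      then show False
      proof
        assume "a \<otimes> b \<in> I"
        then obtain r where r: "r \<in> carrier R" "a \<otimes> b = r \<otimes> (a \<otimes> b \<otimes> c)"
          unfolding I_def cgenideal_def by blast
        \<comment> \<open>After regrouping, \<open>a \<otimes> b\<close> is fixed by the factor
          \<open>r \<otimes> c\<close>, which is in \<open>M\<close> because \<open>c\<close>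
          is.\<close>
        have "r \<otimes> (a \<otimes> b \<otimes> c) = (r \<otimes> c) \<otimes> (a \<otimes> b)"
          using r(1) R by (simp add: m_ac)
        then have "a \<otimes> b = \<zero>"
          using fixed[of "r \<otimes> c" "a \<otimes> b"] M.I_l_closed[OF abc(3) r(1)] r(2) R by simp
        then show False
          using nz R by simp
      next
        assume "c \<in> I"
        then obtain r where r: "r \<in> carrier R" "c = r \<otimes> (a \<otimes> b \<otimes> c)"
          unfolding I_def cgenideal_def by blast
        \<comment> \<open>Here the factor fixing \<open>c\<close> is in \<open>M\<close> because
          \<open>b\<close> is.\<close>
        have "r \<otimes> (a \<otimes> b \<otimes> c) = (r \<otimes> a \<otimes> b) \<otimes> c"
          using r(1) R by (simp add: m_ac)
        then have "c = \<zero>"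
          using fixed[of "r \<otimes> a \<otimes> b" c] M.I_l_closed[OF abc(2), of "r \<otimes> a"] r R by simp
        then show False
          using nz R by simp
      qed
    qed
  next
    fix I
    assume zero: "\<forall>a\<in>M. \<forall>b\<in>M. \<forall>c\<in>M. a \<otimes> b \<otimes> c = \<zero>"
      and I: "ideal I R \<and> I \<noteq> carrier R"
    then show "weakly_1_absorbing_prime_ideal I R"
      using nonunits
      by (intro weakly_1_absorbing_prime_ideal.intro weakly_1_absorbing_prime_ideal_axioms.intro
            is_cring) auto
  qed
qed

end
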